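(* Consider the optimization problem $$\text{(P)}\qquad \min_{v\in\mathbb{R}^{I T}}\ C(v)=\sum_{t=1}^{T}\left[e^{\alpha g_t(v_1,\dots,v_t)}+f\Big(\ell_t+\sum_{i=1}^{I}v_{i,t}\Big)\right]$$ subject to $$\sum_{t=1}^{T}v_{i,t}\ge S_i\quad\text{for all } i\in\{1,\dots,I\},$$ $$0\le v_{i,t}\le V_{\max}\quad\text{for all } i\in\{1,\dots,I\},\ t\in\{1,\dots,T\},$$ $$g_t(v_1,\dots,v_t)\le x_{\max}\quad\text{for all } t\in\{1,\dots,T\},$$ where the data and the functions $g_t$ are as specified in the context. Then: (i) If $S_i\le V_{\max}\,T$ for all $i\in\{1,\dots,I\}$, and $g_t(\tilde v_1,\dots,\tilde v_t)\le x_{\max}$ for all $t\in\{1,\dots,T\}$, where $\tilde v_t=\left(\frac{S_1}{T},\dots,\frac{S_I}{T}\right)$ for every $t$, then (P) has at least one optimal solution. (ii) In general (P) has multiple optimal solutions; that is, optimal solutions need not be unique: there exist admissible data for which (P) has more than one optimal solution. (iii) If $ab_1+b_2\ge 0$, then (P) is a convex optimization problem (a convex objective function is minimized subject to constraints given by affine inequalities and inequalities $g_t\le x_{\max}$ with $g_t$ convex).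
   Context: $T\ge1$ is the number of time-slots, indexed by $t\in\{1,\dots,T\}$, and $I\ge 1$ is the number of electric vehicles (EVs), indexed by $i\in\{1,\dots,I\}$. The variable $v_{i,t}$ is the charging power (load) of EV $i$ at time $t$. Write $v_t=(v_{1,t},\dots,v_{I,t})$ and $v=(v_{i,t})_{i,t}\in\mathbb{R}^{IT}$. Data: - $\ell_t\ge0$ is the known non-EV load at time $t$. The total load is $u_t=\ell_t+\sum_{i=1}^{I}v_{i,t}$ for $t\in\{1,\dots,T\}$. - $S_i\ge0$ is the charging need of EV $i$. - $V_{\max}>0$ is the maximal charging power. - $x_{\max}$ is the maximal admissible transformer hot-spot temperature. - $\alpha>0$ is a real constant. - $f:[0,\infty)\to\mathbb{R}$ is non-decreasing and convex. - $0\le a\le 1$, $b_1\ge 0$, $b_2\le 0$ are real constants. - $(c_t)_{1\le t\le T}$ is a known deterministic real sequence, and $(x_0,u_0)$ is a given pair of initial values. These are such that the temperatures $x_t$ defined below are nonnegative. The hot-spot temperature (state) $x_t$ evolves according to $$x_t=a x_{t-1}+b_1u_t^2+b_2u_{t-1}^2+c_t,\qquad t\in\{1,\dots,T\}.$$ The function $g_t$ expresses $x_t$ in terms of the controls, $x_t=g_t(v_1,\dots,v_t)$; explicitly, $$g_t(v_1,\dots,v_t)=a^t x_0+b_1\Big(\ell_t+\sum_{i=1}^{I}v_{i,t}\Big)^2+b_2a^{t-1}u_0^2+(ab_1+b_2)\sum_{t'=1}^{t-1}a^{t'-1}\Big(\ell_{t-t'}+\sum_{i=1}^{I}v_{i,t-t'}\Big)^2+\sum_{t'=1}^{t}a^{t-t'}c_{t'},$$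 with the convention $a^0=1$. *)

theory Defs
  imports "HOL-Analysis.Analysis" "HOL-Library.Function_Algebras"
begin

text \<open>
  Charging profiles are functions of type \<^typ>\<open>nat \<Rightarrow> nat \<Rightarrow> real\<close> (EV index, then time slot).
  The pointwise operations turn functions into a real vector space, so that the library notions
  \<^const>\<open>linear\<close> and \<^const>\<open>convex_on\<close> apply to them.
\<close>

instantiation "fun" :: (type, real_vector) real_vector
begin

definition scaleR_fun :: "real \<Rightarrow> ('a \<Rightarrow> 'b) \<Rightarrow> 'a \<Rightarrow> 'b"
  where "scaleR_fun r h = (\<lambda>x. r *\<^sub>R h x)"

instance
  by standard (auto simp: scaleR_fun_def plus_fun_def scaleR_right_distrib scaleR_left_distrib)

end

record ev_data =
  horizon :: nat                  (* T *)
  num_evs :: nat                  (* I *)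
  base_load :: "nat \<Rightarrow> real"      (* l_t *)
  need :: "nat \<Rightarrow> real"           (* S_i *)
  v_max :: real
  x_max :: real
  alpha :: real
  f_cost :: "real \<Rightarrow> real"        (* f; only its values on [0, infinity) matter *)
  a_coef :: real
  b1_coef :: real
  b2_coef :: real
  c_seq :: "nat \<Rightarrow> real"
  init_temp :: real               (* x_0 *)
  init_load :: real               (* u_0 *)

text \<open>
  The space R^(IT): profiles vanishing outside the index range, so that two profiles are equal
  iff their entries \<open>v i t\<close> with \<open>1 \<le> i \<le> I\<close>, \<open>1 \<le> t \<le> T\<close> agree.
\<close>

definition profiles :: "ev_data \<Rightarrow> (nat \<Rightarrow> nat \<Rightarrow> real) set" where
  "profiles d = {v. \<forall>i t. \<not> (i \<in> {1..num_evs d} \<and> t \<in> {1..horizon d}) \<longrightarrow> v i t = 0}"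

definition total_load :: "ev_data \<Rightarrow> (nat \<Rightarrow> nat \<Rightarrow> real) \<Rightarrow> nat \<Rightarrow> real" where
  "total_load d v t = base_load d t + (\<Sum>i=1..num_evs d. v i t)"

fun temperature :: "ev_data \<Rightarrow> (nat \<Rightarrow> nat \<Rightarrow> real) \<Rightarrow> nat \<Rightarrow> real" where
  "temperature d v 0 = init_temp d"
| "temperature d v (Suc t) =
     a_coef d * temperature d v t + b1_coef d * (total_load d v (Suc t))\<^sup>2
     + b2_coef d * (if t = 0 then init_load d else total_load d v t)\<^sup>2 + c_seq d (Suc t)"

definition g_fun :: "ev_data \<Rightarrow> nat \<Rightarrow> (nat \<Rightarrow> nat \<Rightarrow> real) \<Rightarrow> real" where
  "g_fun d t v =
     a_coef d ^ t * init_temp d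
     + b1_coef d * (base_load d t + (\<Sum>i=1..num_evs d. v i t))\<^sup>2
     + b2_coef d * a_coef d ^ (t - 1) * (init_load d)\<^sup>2
     + (a_coef d * b1_coef d + b2_coef d) *
         (\<Sum>s=1..t-1. a_coef d ^ (s - 1)
            * (base_load d (t - s) + (\<Sum>i=1..num_evs d. v i (t - s)))\<^sup>2)
     + (\<Sum>s=1..t. a_coef d ^ (t - s) * c_seq d s)"

lemma g_fun_eq_temperature:
  assumes "t \<ge> 1"
  shows "g_fun d t v = temperature d v t"
  using assms
proof (induction t rule: nat_induct_at_least)
  case base
  show ?case by (simp add: g_fun_def total_load_def)
next
  case (Suc t)
  then obtain n where n: "t = Suc n" by (cases t) auto
  let ?L = "total_load d v" and ?a = "a_coef d"
  have g: "g_fun d t v = ?a ^ t * init_temp d + b1_coef d * (?L t)\<^sup>2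
     + b2_coef d * ?a ^ (t - 1) * (init_load d)\<^sup>2
     + (?a * b1_coef d + b2_coef d) * (\<Sum>s=1..t-1. ?a ^ (s - 1) * (?L (t - s))\<^sup>2)
     + (\<Sum>s=1..t. ?a ^ (t - s) * c_seq d s)" for t
    by (simp add: g_fun_def total_load_def)
  have "(\<Sum>s=1..t. ?a ^ (s - 1) * (?L (Suc t - s))\<^sup>2)
      = (?L t)\<^sup>2 + (\<Sum>s=Suc 1..Suc n. ?a ^ (s - 1) * (?L (Suc t - s))\<^sup>2)"
    unfolding n by (subst sum.atLeast_Suc_atMost) auto
  also have "(\<Sum>s=Suc 1..Suc n. ?a ^ (s - 1) * (?L (Suc t - s))\<^sup>2)
      = (\<Sum>s=1..n. ?a ^ s * (?L (t - s))\<^sup>2)"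
    by (subst sum.shift_bounds_cl_Suc_ivl) simp
  also have "\<dots> = ?a * (\<Sum>s=1..n. ?a ^ (s - 1) * (?L (t - s))\<^sup>2)"
    unfolding sum_distrib_left
  proof (rule sum.cong)
    fix s assume "s \<in> {1..n}"
    then show "?a ^ s * (?L (t - s))\<^sup>2 = ?a * (?a ^ (s - 1) * (?L (t - s))\<^sup>2)"
      by (cases s) auto
  qed simp
  finally have quad: "(\<Sum>s=1..t. ?a ^ (s - 1) * (?L (Suc t - s))\<^sup>2)
      = (?L t)\<^sup>2 + ?a * (\<Sum>s=1..n. ?a ^ (s - 1) * (?L (t - s))\<^sup>2)" .
  have lin: "(\<Sum>s=1..Suc t. ?a ^ (Suc t - s) * c_seq d s)
      = ?a * (\<Sum>s=1..t. ?a ^ (t - s) * c_seq d s) + c_seq d (Suc t)"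
    by (simp add: sum_distrib_left Suc_diff_le mult.assoc)
  have pow: "?a ^ t = ?a * ?a ^ (t - 1)" by (simp add: n)
  have "g_fun d (Suc t) v = ?a * g_fun d t v + b1_coef d * (?L (Suc t))\<^sup>2
      + b2_coef d * (?L t)\<^sup>2 + c_seq d (Suc t)"
    unfolding g lin using quad pow by (simp add: n algebra_simps)
  then show ?case using Suc n by simp
qed

text \<open>
  Nonnegativity of the temperatures is required for all profiles respecting the power limits:
  for \<open>b2 < 0\<close> it could not be expected for arbitrarily large loads.
\<close>

definition admissible_data :: "ev_data \<Rightarrow> bool" where
  "admissible_data d \<longleftrightarrow>
     horizon d \<ge> 1 \<and> num_evs d \<ge> 1
     \<and> (\<forall>t\<in>{1..horizon d}. base_load d t \<ge> 0)
     \<and> (\<forall>i\<in>{1..num_evs d}. need d i \<ge> 0)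
     \<and> v_max d > 0 \<and> alpha d > 0
     \<and> mono_on {0..} (f_cost d) \<and> convex_on {0..} (f_cost d)
     \<and> 0 \<le> a_coef d \<and> a_coef d \<le> 1 \<and> b1_coef d \<ge> 0 \<and> b2_coef d \<le> 0
     \<and> (\<forall>v\<in>profiles d.
          (\<forall>i\<in>{1..num_evs d}. \<forall>t\<in>{1..horizon d}. 0 \<le> v i t \<and> v i t \<le> v_max d) \<longrightarrow>
          (\<forall>t\<in>{1..horizon d}. temperature d v t \<ge> 0))"

definition cost :: "ev_data \<Rightarrow> (nat \<Rightarrow> nat \<Rightarrow> real) \<Rightarrow> real" where
  "cost d v = (\<Sum>t=1..horizon d.
     exp (alpha d * g_fun d t v) + f_cost d (base_load d t + (\<Sum>i=1..num_evs d. v i t)))"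

definition feasible :: "ev_data \<Rightarrow> (nat \<Rightarrow> nat \<Rightarrow> real) set" where
  "feasible d = {v \<in> profiles d.
     (\<forall>i\<in>{1..num_evs d}. (\<Sum>t=1..horizon d. v i t) \<ge> need d i)
     \<and> (\<forall>i\<in>{1..num_evs d}. \<forall>t\<in>{1..horizon d}. 0 \<le> v i t \<and> v i t \<le> v_max d)
     \<and> (\<forall>t\<in>{1..horizon d}. g_fun d t v \<le> x_max d)}"

definition optimal_solution :: "ev_data \<Rightarrow> (nat \<Rightarrow> nat \<Rightarrow> real) \<Rightarrow> bool" where
  "optimal_solution d v \<longleftrightarrow> is_arg_min (cost d) (\<lambda>w. w \<in> feasible d) v"

definition uniform_profile :: "ev_data \<Rightarrow> nat \<Rightarrow> nat \<Rightarrow> real" where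
  "uniform_profile d = (\<lambda>i t.
     if i \<in> {1..num_evs d} \<and> t \<in> {1..horizon d} then need d i / real (horizon d) else 0)"

text \<open>
  Minimize \<open>C\<close>, with domain \<open>D\<close>, over the feasible set \<open>F\<close> inside the space \<open>E\<close>. A constraint is a
  pair \<open>(h, r)\<close> standing for the inequality \<open>h v \<le> r\<close>; it is affine if \<open>h\<close> is linear.
\<close>

definition convex_optimization_problem ::
  "'v::real_vector set \<Rightarrow> 'v set \<Rightarrow> ('v \<Rightarrow> real) \<Rightarrow> (('v \<Rightarrow> real) \<times> real) set
   \<Rightarrow> (('v \<Rightarrow> real) \<times> real) set \<Rightarrow> 'v set \<Rightarrow> bool" where
  "convex_optimization_problem E D C A G F \<longleftrightarrow>
     subspace E \<and> D \<subseteq> E \<and> convex_on D C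
     \<and> (\<forall>(h, r)\<in>A. linear h)
     \<and> (\<forall>(h, r)\<in>G. convex_on E h)
     \<and> F = {v \<in> E. \<forall>(h, r)\<in>A \<union> G. h v \<le> r}
     \<and> F \<subseteq> D"

text \<open>
  As \<open>f\<close> is only given on \<open>[0, \<infinity>)\<close>, the objective is defined where all total loads are nonnegative.
\<close>

definition cost_domain :: "ev_data \<Rightarrow> (nat \<Rightarrow> nat \<Rightarrow> real) set" where
  "cost_domain d = {v \<in> profiles d. \<forall>t\<in>{1..horizon d}. total_load d v t \<ge> 0}"

definition affine_constraints :: "ev_data \<Rightarrow> (((nat \<Rightarrow> nat \<Rightarrow> real) \<Rightarrow> real) \<times> real) set" where
  "affine_constraints d =
     {(\<lambda>v. - (\<Sum>t=1..horizon d. v i t), - need d i) | i. i \<in> {1..num_evs d}}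
     \<union> {(\<lambda>v. - v i t, 0) | i t. i \<in> {1..num_evs d} \<and> t \<in> {1..horizon d}}
     \<union> {(\<lambda>v. v i t, v_max d) | i t. i \<in> {1..num_evs d} \<and> t \<in> {1..horizon d}}"

definition temperature_constraints :: "ev_data \<Rightarrow> (((nat \<Rightarrow> nat \<Rightarrow> real) \<Rightarrow> real) \<times> real) set" where
  "temperature_constraints d = {(g_fun d t, x_max d) | t. t \<in> {1..horizon d}}"

end

theory Submission
  imports Defs
begin

text \<open>
  Existence is the extreme value theorem. In the product topology the feasible set is a closed
  subset of a compact box, and it contains the uniform profile. The cost is continuous there: a
  convex function on a closed half-line is continuous in the interior, and at the end point a
  monotone convex function is squeezed between its end value and a chord
  (\<open>mono_convex_continuous_on_atLeast\<close>).

  Non-uniqueness comes from the fact that cost and temperature depend on the profiles only through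
  the total loads, so that vehicles with equal needs can be interchanged. In the witness, two
  vehicles that each need one unit share two slots, and every feasible schedule with total load
  \<open>1\<close> in each slot is optimal. There are two such schedules in which each vehicle uses a single slot.

  Convexity holds because the total loads are affine in the profile, and \<open>g\<close> is a constant plus
  a combination of squares of total loads whose coefficients are nonnegative once
  \<open>a b1 + b2 \<ge> 0\<close>. The exponential and \<open>f\<close> are convex, and the former is increasing, so the cost
  inherits convexity from \<open>g\<close> and the total loads.
\<close>

section \<open>Existence of optimal solutions\<close>

text \<open>
  Monotonicity is essential at the left end point, where a convex function may jump up.
\<close>

lemma mono_convex_continuous_on_atLeast:
  fixes f :: "real \<Rightarrow> real"
  assumes mono: "mono_on {0..} f" and conv: "convex_on {0..} f"
  shows "continuous_on {0..} f"
  unfolding continuous_on_eq_continuous_within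
proof
  fix x :: real
  assume x: "x \<in> {0..}"
  show "continuous (at x within {0..}) f"
  proof (cases "x = 0")
    case False
    have "convex_on {0<..} f"
      using conv by (rule convex_on_subset) auto
    then have "continuous_on {0<..} f"
      by (intro convex_on_continuous) auto
    then have "isCont f x"
      using False x by (simp add: continuous_on_eq_continuous_at)
    then show ?thesis
      by (rule continuous_at_imp_continuous_at_within)
  next
    case True
    have lower: "\<forall>\<^sub>F y in at 0 within {0..}. f 0 \<le> f y"
      unfolding eventually_at_filter
      by (rule always_eventually) (auto intro: mono_onD[OF mono])
    have "f y \<le> (1 - y) * f 0 + y * f 1" if "0 \<le> y" "y \<le> 1" for y
      using convex_onD[OF conv, of y 0 1] that by simp
    moreover have "\<forall>\<^sub>F y in at 0 within {0..}. y < (1::real)"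
      using order_tendstoD(2)[OF tendsto_ident_at, of "0::real" 1 "{0..}"] by simp
    moreover have "\<forall>\<^sub>F y in at 0 within {0..}. y \<in> {0::real..}"
      by (simp add: eventually_at_filter)
    ultimately have upper: "\<forall>\<^sub>F y in at 0 within {0..}. f y \<le> (1 - y) * f 0 + y * f 1"
      by (auto elim: eventually_elim2)
    have "((\<lambda>y. (1 - y) * f 0 + y * f 1) \<longlongrightarrow> (1 - 0) * f 0 + 0 * f 1) (at 0 within {0..})"
      by (intro tendsto_intros)
    then have "((\<lambda>y. (1 - y) * f 0 + y * f 1) \<longlongrightarrow> f 0) (at 0 within {0..})"
      by simp
    then have "(f \<longlongrightarrow> f 0) (at 0 within {0..})"
      by (rule tendsto_sandwich[OF lower upper tendsto_const])
    then show ?thesis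
      by (simp add: True continuous_within)
  qed
qed

lemma continuous_on_entry [continuous_intros]:
  fixes S :: "(nat \<Rightarrow> nat \<Rightarrow> real) set"
  shows "continuous_on S (\<lambda>v. v i t)"
  by (rule continuous_on_subset[OF continuous_on_product_then_coordinatewise
        [OF continuous_on_product_coordinates]]) simp

lemma continuous_on_total_load [continuous_intros]:
  "continuous_on S (\<lambda>v. total_load d v t)"
  unfolding total_load_def by (intro continuous_intros)

lemma g_fun_total_load:
  "g_fun d t v =
     a_coef d ^ t * init_temp d + b1_coef d * (total_load d v t)\<^sup>2
     + b2_coef d * a_coef d ^ (t - 1) * (init_load d)\<^sup>2
     + (a_coef d * b1_coef d + b2_coef d) *
         (\<Sum>s=1..t-1. a_coef d ^ (s - 1) * (total_load d v (t - s))\<^sup>2)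
     + (\<Sum>s=1..t. a_coef d ^ (t - s) * c_seq d s)"
  by (simp add: g_fun_def total_load_def)

lemma cost_total_load:
  "cost d v = (\<Sum>t=1..horizon d. exp (alpha d * g_fun d t v) + f_cost d (total_load d v t))"
  by (simp add: cost_def total_load_def)

lemma continuous_on_g_fun [continuous_intros]:
  "continuous_on S (g_fun d t)"
  unfolding g_fun_total_load[abs_def] by (intro continuous_intros)

lemma compact_box:
  fixes lo hi :: "nat \<Rightarrow> nat \<Rightarrow> real"
  shows "compact {v. \<forall>i t. lo i t \<le> v i t \<and> v i t \<le> hi i t}"
proof -
  have row: "compact (PiE UNIV (\<lambda>t. {lo i t..hi i t}))" for i
    unfolding compactin_euclidean_iff[symmetric] euclidean_product_topology[symmetric]
      compactin_PiE
    by simp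
  have "compact (PiE UNIV (\<lambda>i. PiE UNIV (\<lambda>t. {lo i t..hi i t})))"
    unfolding compactin_euclidean_iff[symmetric] euclidean_product_topology[symmetric]
      compactin_PiE
    using row by (simp add: euclidean_product_topology)
  also have "PiE UNIV (\<lambda>i. PiE UNIV (\<lambda>t. {lo i t..hi i t}))
      = {v. \<forall>i t. lo i t \<le> v i t \<and> v i t \<le> hi i t}"
    by (auto simp: PiE_def Pi_def)
  finally show ?thesis .
qed

lemma compact_feasible: "compact (feasible d)"
proof -
  define hi where "hi i t = (if i \<in> {1..num_evs d} \<and> t \<in> {1..horizon d} then v_max d else 0)"
    for i t
  let ?box = "{v. \<forall>i t. (0::real) \<le> v i t \<and> v i t \<le> hi i t}"
  let ?N = "\<Inter>i\<in>{1..num_evs d}. {v. need d i \<le> (\<Sum>t=1..horizon d. v i t)}"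
  let ?G = "\<Inter>t\<in>{1..horizon d}. {v. g_fun d t v \<le> x_max d}"
  have box: "v \<in> ?box \<longleftrightarrow> v \<in> profiles d
      \<and> (\<forall>i\<in>{1..num_evs d}. \<forall>t\<in>{1..horizon d}. 0 \<le> v i t \<and> v i t \<le> v_max d)" for v
    unfolding profiles_def hi_def mem_Collect_eq
    by (smt (verit, best))
  have eq: "feasible d = ?box \<inter> (?N \<inter> ?G)"
    unfolding set_eq_iff Int_iff box by (auto simp: feasible_def)
  have "closed ?N" "closed ?G"
    by (intro closed_INT ballI closed_Collect_le continuous_intros)+
  then have "closed (?N \<inter> ?G)"
    by (rule closed_Int)
  then show ?thesis
    unfolding eq by (rule compact_Int_closed[OF compact_box[of "\<lambda>_ _. 0" hi, simplified]])
qed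

lemma total_load_nonneg:
  assumes "admissible_data d" "v \<in> feasible d" "t \<in> {1..horizon d}"
  shows "total_load d v t \<ge> 0"
  using assms unfolding admissible_data_def feasible_def total_load_def
  by (auto intro!: add_nonneg_nonneg sum_nonneg)

lemma continuous_on_cost:
  assumes adm: "admissible_data d"
  shows "continuous_on (feasible d) (cost d)"
proof -
  have "continuous_on {0..} (f_cost d)"
    using adm by (intro mono_convex_continuous_on_atLeast) (auto simp: admissible_data_def)
  then have "continuous_on (feasible d) (\<lambda>v. f_cost d (total_load d v t))"
    if "t \<in> {1..horizon d}" for t
    using that total_load_nonneg[OF adm]
    by (auto intro: continuous_on_compose2[OF _ continuous_on_total_load])
  then show ?thesis
    unfolding cost_total_load[abs_def] by (intro continuous_intros)
qed

lemma uniform_profile_feasible: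
  assumes adm: "admissible_data d"
    and need: "\<forall>i\<in>{1..num_evs d}. need d i \<le> v_max d * real (horizon d)"
    and temp: "\<forall>t\<in>{1..horizon d}. g_fun d t (uniform_profile d) \<le> x_max d"
  shows "uniform_profile d \<in> feasible d"
proof -
  have T: "real (horizon d) > 0"
    using adm by (simp add: admissible_data_def)
  have "uniform_profile d \<in> profiles d"
    by (auto simp: profiles_def uniform_profile_def)
  moreover have "(\<Sum>t=1..horizon d. uniform_profile d i t) = need d i"
    if "i \<in> {1..num_evs d}" for i
    using that T by (simp add: uniform_profile_def)
  moreover have "0 \<le> uniform_profile d i t \<and> uniform_profile d i t \<le> v_max d"
    if "i \<in> {1..num_evs d}" "t \<in> {1..horizon d}" for i t
    using that adm need T by (auto simp: uniform_profile_def admissible_data_def divide_le_eq)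
  ultimately show ?thesis
    using temp by (simp add: feasible_def)
qed

lemma optimal_solution_exists:
  assumes adm: "admissible_data d" and ne: "feasible d \<noteq> {}"
  shows "\<exists>v. optimal_solution d v"
proof -
  obtain v where "v \<in> feasible d" "\<forall>w\<in>feasible d. cost d v \<le> cost d w"
    using continuous_attains_inf[OF compact_feasible ne continuous_on_cost[OF adm]] by blast
  then show ?thesis
    by (auto simp: optimal_solution_def is_arg_min_def not_less)
qed

section \<open>Non-uniqueness\<close>

text \<open>
  With \<open>a = b2 = 0\<close> and \<open>b1 = 1\<close> the temperature is the squared total load, so the optimal value
  can be bounded by hand. The bound \<open>x_max = 4\<close> is the largest squared load of two vehicles, so
  the temperature constraint excludes no schedule.
\<close>

definition swap_data :: ev_data where
  "swap_data = \<lparr>horizon = 2, num_evs = 2, base_load = (\<lambda>_. 0), need = (\<lambda>_. 1), v_max = 1,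
     x_max = 4, alpha = 1, f_cost = (\<lambda>x. x), a_coef = 0, b1_coef = 1, b2_coef = 0,
     c_seq = (\<lambda>_. 0), init_temp = 0, init_load = 0\<rparr>"

definition same_slot :: "nat \<Rightarrow> nat \<Rightarrow> real" where
  "same_slot i t = (if i \<in> {1..2} \<and> t = i then 1 else 0)"

definition other_slot :: "nat \<Rightarrow> nat \<Rightarrow> real" where
  "other_slot i t = (if i \<in> {1..2} \<and> t = 3 - i then 1 else 0)"

lemma swap_data_g_fun:
  "g_fun swap_data t v = (v 1 t + v 2 t)\<^sup>2" if "t \<in> {1..2}"
  using that by (simp add: swap_data_def g_fun_def numeral_2_eq_2)

lemma swap_data_cost:
  "cost swap_data v = exp ((v 1 1 + v 2 1)\<^sup>2) + (v 1 1 + v 2 1)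
     + exp ((v 1 2 + v 2 2)\<^sup>2) + (v 1 2 + v 2 2)"
proof -
  have "cost swap_data v = (\<Sum>t=1..2. exp (g_fun swap_data t v) + (v 1 t + v 2 t))"
    by (simp add: cost_def swap_data_def numeral_2_eq_2)
  also have "\<dots> = (\<Sum>t=1..2. exp ((v 1 t + v 2 t)\<^sup>2) + (v 1 t + v 2 t))"
    by (intro sum.cong) (simp_all only: swap_data_g_fun)
  finally show ?thesis
    by (simp add: numeral_2_eq_2)
qed

lemma swap_data_admissible: "admissible_data swap_data"
proof -
  have "temperature swap_data v t \<ge> 0" for v t
    by (induction t) (simp_all add: swap_data_def)
  then show ?thesis
    by (simp add: admissible_data_def) (simp add: swap_data_def mono_on_def convex_on_ident)
qed

text \<open>
  The tangent of \<open>exp\<close> at \<open>1\<close> followed by the tangent of the square at \<open>1\<close>, the load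
  of each slot in a balanced schedule.
\<close>

lemma exp_square_ge_tangent: "exp (x\<^sup>2) \<ge> exp 1 * (2 * x - 1)" for x :: real
proof -
  have "2 * x - 1 \<le> x\<^sup>2"
    using zero_le_power2[of "x - 1"] by (simp add: power2_diff)
  also have "\<dots> \<le> exp (x\<^sup>2 - 1)"
    using exp_ge_add_one_self[of "x\<^sup>2 - 1"] by simp
  finally show ?thesis
    by (simp add: exp_diff field_simps)
qed

lemma swap_data_cost_ge:
  assumes "v \<in> feasible swap_data"
  shows "cost swap_data v \<ge> 2 * exp 1 + 2"
proof -
  let ?x = "v 1 1 + v 2 1" and ?y = "v 1 2 + v 2 2"
  have "v 1 1 + v 1 2 \<ge> 1" "v 2 1 + v 2 2 \<ge> 1"
    using assms by (auto simp: feasible_def swap_data_def numeral_2_eq_2)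
  then have xy: "?x + ?y \<ge> 2"
    by simp
  have "2 * exp 1 \<le> exp (1::real) * (2 * (?x + ?y) - 2)"
    using mult_left_mono[OF xy, of "exp 1"] by (simp add: algebra_simps)
  also have "\<dots> = exp 1 * (2 * ?x - 1) + exp 1 * (2 * ?y - 1)"
    by (simp add: algebra_simps)
  also have "\<dots> \<le> exp (?x\<^sup>2) + exp (?y\<^sup>2)"
    by (intro add_mono exp_square_ge_tangent)
  finally show ?thesis
    using xy by (simp add: swap_data_cost)
qed

lemma swap_data_optimal:
  assumes "v \<in> feasible swap_data" "v 1 1 + v 2 1 = 1" "v 1 2 + v 2 2 = 1"
  shows "optimal_solution swap_data v"
proof -
  have "cost swap_data v = 2 * exp 1 + 2"
    using assms by (simp add: swap_data_cost)
  then show ?thesis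
    using assms(1) swap_data_cost_ge by (auto simp: optimal_solution_def is_arg_min_def not_less)
qed

lemma swap_data_feasible:
  assumes "v \<in> profiles swap_data" "\<And>i t. v i t \<in> {0..1}"
    and "v 1 1 + v 1 2 = 1" "v 2 1 + v 2 2 = 1"
    and "v 1 1 + v 2 1 = 1" "v 1 2 + v 2 2 = 1"
  shows "v \<in> feasible swap_data"
proof -
  have "g_fun swap_data t v \<le> 4" if "t \<in> {1..2}" for t
  proof -
    have "t = 1 \<or> t = 2"
      using that by auto
    then show ?thesis
      using assms(5,6) by (auto simp: swap_data_g_fun[OF that])
  qed
  moreover have "(\<Sum>t=1..2. v i t) = 1" if "i \<in> {1..2}" for i
  proof -
    have "i = 1 \<or> i = 2"
      using that by auto
    then show ?thesis
      using assms(3,4) by (auto simp: numeral_2_eq_2)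
  qed
  moreover have "horizon swap_data = 2" "num_evs swap_data = 2" "need swap_data = (\<lambda>_. 1)"
      "v_max swap_data = 1" "x_max swap_data = 4"
    by (simp_all add: swap_data_def)
  ultimately show ?thesis
    using assms(1,2) by (simp add: feasible_def)
qed

lemma same_slot_optimal: "optimal_solution swap_data same_slot"
  by (intro swap_data_optimal swap_data_feasible)
    (auto simp: same_slot_def profiles_def swap_data_def)

lemma other_slot_optimal: "optimal_solution swap_data other_slot"
  by (intro swap_data_optimal swap_data_feasible)
    (auto simp: other_slot_def profiles_def swap_data_def)

lemma same_slot_neq_other_slot: "same_slot \<noteq> other_slot"
proof
  assume "same_slot = other_slot"
  then have "same_slot 1 1 = other_slot 1 1"
    by simp
  then show False
    by (simp add: same_slot_def other_slot_def)
qed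

section \<open>Convexity\<close>

lemma convex_on_compose_mono:
  fixes f :: "real \<Rightarrow> real"
  assumes g: "convex_on S g" and f: "convex_on T f" "mono_on T f" and T: "g ` S \<subseteq> T"
  shows "convex_on S (\<lambda>x. f (g x))"
  unfolding convex_on_def
proof (intro conjI ballI allI impI)
  show S: "convex S"
    using g by (rule convex_on_imp_convex)
  fix x y and u v :: real
  assume H: "x \<in> S" "y \<in> S" "0 \<le> u" "0 \<le> v" "u + v = 1"
  have "u *\<^sub>R g x + v *\<^sub>R g y \<in> T"
    using H T convexD[OF convex_on_imp_convex[OF f(1)]] by blast
  moreover have "u *\<^sub>R x + v *\<^sub>R y \<in> S"
    using H S by (simp add: convexD)
  moreover have "g (u *\<^sub>R x + v *\<^sub>R y) \<le> u *\<^sub>R g x + v *\<^sub>R g y"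
    using g H by (simp add: convex_on_def)
  ultimately have "f (g (u *\<^sub>R x + v *\<^sub>R y)) \<le> f (u *\<^sub>R g x + v *\<^sub>R g y)"
    using T by (intro mono_onD[OF f(2)]) auto
  also have "\<dots> \<le> u * f (g x) + v * f (g y)"
    using f(1) H T unfolding convex_on_def by blast
  finally show "f (g (u *\<^sub>R x + v *\<^sub>R y)) \<le> u * f (g x) + v * f (g y)" .
qed

lemma convex_on_compose_affine:
  fixes f :: "real \<Rightarrow> real"
  assumes f: "convex_on T f" and S: "convex S" and T: "L ` S \<subseteq> T"
    and L: "\<And>x y u v. u + v = 1 \<Longrightarrow> L (u *\<^sub>R x + v *\<^sub>R y) = u * L x + v * L y"
  shows "convex_on S (\<lambda>x. f (L x))"
  using f S T unfolding convex_on_def by (auto simp: L image_subset_iff)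

lemma convex_on_sum_functions:
  assumes "convex S" "\<And>i. i \<in> A \<Longrightarrow> convex_on S (f i)"
  shows "convex_on S (\<lambda>x. \<Sum>i\<in>A. f i x)"
  using assms
  by (induction A rule: infinite_finite_induct) (auto simp: convex_on_const)

lemma scaleR_profile: "(r *\<^sub>R v) i t = r * v i t" for v :: "nat \<Rightarrow> nat \<Rightarrow> real"
  by (simp add: scaleR_fun_def)

lemma total_load_affine:
  assumes "u + w = 1"
  shows "total_load d (u *\<^sub>R x + w *\<^sub>R y) t = u * total_load d x t + w * total_load d y t"
proof -
  have "base_load d t = u * base_load d t + w * base_load d t"
    using assms by (metis distrib_right mult_1)
  then show ?thesis
    by (simp add: total_load_def scaleR_profile sum.distrib sum_distrib_left algebra_simps)
qed

lemma subspace_profiles: "subspace (profiles d)"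
  by (auto simp: subspace_def profiles_def scaleR_profile)

lemma convex_cost_domain: "convex (cost_domain d)"
proof (rule convexI)
  fix x y and u w :: real
  assume H: "x \<in> cost_domain d" "y \<in> cost_domain d" "0 \<le> u" "0 \<le> w" "u + w = 1"
  then have "u *\<^sub>R x + w *\<^sub>R y \<in> profiles d"
    using subspace_profiles by (auto simp: cost_domain_def intro!: subspace_add subspace_scale)
  with H show "u *\<^sub>R x + w *\<^sub>R y \<in> cost_domain d"
    by (simp add: cost_domain_def total_load_affine)
qed

lemma convex_on_g_fun:
  assumes adm: "admissible_data d" and ab: "a_coef d * b1_coef d + b2_coef d \<ge> 0"
    and S: "convex S"
  shows "convex_on S (g_fun d t)"
proof -
  have sq: "convex_on S (\<lambda>v. (total_load d v t)\<^sup>2)" for t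
    by (rule convex_on_compose_affine[OF convex_power2 S]) (simp_all add: total_load_affine)
  have const: "convex_on S (\<lambda>_. k)" for k :: real
    using S by (simp add: convex_on_const)
  have "a_coef d \<ge> 0" "b1_coef d \<ge> 0"
    using adm by (simp_all add: admissible_data_def)
  then show ?thesis
    unfolding g_fun_total_load[abs_def]
    by (intro const convex_on_add convex_on_cmul convex_on_sum_functions S sq ab zero_le_power)
qed

lemma convex_on_cost:
  assumes adm: "admissible_data d" and ab: "a_coef d * b1_coef d + b2_coef d \<ge> 0"
  shows "convex_on (cost_domain d) (cost d)"
proof -
  note S = convex_cost_domain
  have "alpha d \<ge> 0" and f: "convex_on {0..} (f_cost d)"
    using adm by (simp_all add: admissible_data_def)
  then have "convex_on (cost_domain d) (\<lambda>v. alpha d * g_fun d t v)" for t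
    by (intro convex_on_cmul convex_on_g_fun[OF adm ab S])
  then have "convex_on (cost_domain d) (\<lambda>v. exp (alpha d * g_fun d t v))" for t
    by (rule convex_on_compose_mono[OF _ exp_convex]) (auto simp: mono_on_def)
  moreover have "convex_on (cost_domain d) (\<lambda>v. f_cost d (total_load d v t))"
    if "t \<in> {1..horizon d}" for t
    using that
    by (intro convex_on_compose_affine[OF f S]) (auto simp: cost_domain_def total_load_affine)
  ultimately show ?thesis
    unfolding cost_total_load[abs_def]
    by (intro convex_on_sum_functions convex_on_add S)
qed

lemma linear_affine_constraints: "(h, r) \<in> affine_constraints d \<Longrightarrow> linear h"
  unfolding affine_constraints_def
  by (auto intro!: linearI simp: scaleR_profile sum.distrib sum_distrib_left sum_negf)

lemma ball_pair_image:
  "(\<forall>(h, r)\<in>{(F i, R i) | i. i \<in> A}. Q h r) \<longleftrightarrow> (\<forall>i\<in>A. Q (F i) (R i))"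
  by blast

lemma ball_pair_image2:
  "(\<forall>(h, r)\<in>{(F i t, R i t) | i t. i \<in> A \<and> t \<in> B}. Q h r)
    \<longleftrightarrow> (\<forall>i\<in>A. \<forall>t\<in>B. Q (F i t) (R i t))"
  by blast

lemma feasible_eq_constraints:
  "feasible d = {v \<in> profiles d.
     \<forall>(h, r)\<in>affine_constraints d \<union> temperature_constraints d. h v \<le> r}"
proof -
  have "(\<forall>(h, r)\<in>affine_constraints d. h v \<le> r) \<longleftrightarrow>
      (\<forall>i\<in>{1..num_evs d}. need d i \<le> (\<Sum>t=1..horizon d. v i t))
      \<and> (\<forall>i\<in>{1..num_evs d}. \<forall>t\<in>{1..horizon d}. - v i t \<le> 0)
      \<and> (\<forall>i\<in>{1..num_evs d}. \<forall>t\<in>{1..horizon d}. v i t \<le> v_max d)" for v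
    unfolding affine_constraints_def ball_Un ball_pair_image ball_pair_image2 conj_assoc by simp
  moreover have "(\<forall>(h, r)\<in>temperature_constraints d. h v \<le> r) \<longleftrightarrow>
      (\<forall>t\<in>{1..horizon d}. g_fun d t v \<le> x_max d)" for v
    unfolding temperature_constraints_def ball_pair_image by simp
  ultimately show ?thesis
    unfolding feasible_def ball_Un by auto
qed

lemma convex_problem:
  assumes adm: "admissible_data d" and ab: "a_coef d * b1_coef d + b2_coef d \<ge> 0"
  shows "convex_optimization_problem (profiles d) (cost_domain d) (cost d)
    (affine_constraints d) (temperature_constraints d) (feasible d)"
  unfolding convex_optimization_problem_def
proof (intro conjI)
  show "\<forall>(h, r)\<in>affine_constraints d. linear h"
    using linear_affine_constraints by blast
  show "\<forall>(h, r)\<in>temperature_constraints d. convex_on (profiles d) h"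
    using convex_on_g_fun[OF adm ab subspace_imp_convex[OF subspace_profiles]]
    by (auto simp: temperature_constraints_def)
  show "feasible d \<subseteq> cost_domain d"
    using total_load_nonneg[OF adm] by (auto simp: cost_domain_def feasible_def)
  show "feasible d = {v \<in> profiles d.
      \<forall>(h, r)\<in>affine_constraints d \<union> temperature_constraints d. h v \<le> r}"
    by (rule feasible_eq_constraints)
qed (use subspace_profiles convex_on_cost[OF adm ab] in \<open>auto simp: cost_domain_def\<close>)

section \<open>The optimization problem\<close>

theorem mainTheorem1:
  shows "(\<forall>d::ev_data. admissible_data d
            \<and> (\<forall>i\<in>{1..num_evs d}. need d i \<le> v_max d * real (horizon d))
            \<and> (\<forall>t\<in>{1..horizon d}. g_fun d t (uniform_profile d) \<le> x_max d)
          \<longrightarrow> (\<exists>v. optimal_solution d v))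
       \<and> (\<exists>d::ev_data. admissible_data d
            \<and> (\<exists>v w. optimal_solution d v \<and> optimal_solution d w \<and> v \<noteq> w))
       \<and> (\<forall>d::ev_data. admissible_data d \<and> a_coef d * b1_coef d + b2_coef d \<ge> 0
          \<longrightarrow> convex_optimization_problem (profiles d) (cost_domain d) (cost d)
                (affine_constraints d) (temperature_constraints d) (feasible d))"
proof (intro conjI)
  show "\<forall>d::ev_data. admissible_data d
      \<and> (\<forall>i\<in>{1..num_evs d}. need d i \<le> v_max d * real (horizon d))
      \<and> (\<forall>t\<in>{1..horizon d}. g_fun d t (uniform_profile d) \<le> x_max d)
      \<longrightarrow> (\<exists>v. optimal_solution d v)"
    using uniform_profile_feasible optimal_solution_exists by blast
  show "\<exists>d::ev_data. admissible_data d
      \<and> (\<exists>v w. optimal_solution d v \<and> optimal_solution d w \<and> v \<noteq> w)"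
    using swap_data_admissible same_slot_optimal other_slot_optimal same_slot_neq_other_slot
    by blast
  show "\<forall>d::ev_data. admissible_data d \<and> a_coef d * b1_coef d + b2_coef d \<ge> 0
      \<longrightarrow> convex_optimization_problem (profiles d) (cost_domain d) (cost d)
            (affine_constraints d) (temperature_constraints d) (feasible d)"
    using convex_problem by blast
qed

end
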